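(* Let $f=h+\overline{g}\in\mathcal{F}_0$. Then for $|z|=r<1$, $$0\le |g'(z)|\le\frac{1}{(1-r)^2}.$$ The estimate is best possible, i.e. for each $r\in[0,1)$ neither the lower bound $0$ can be replaced by a larger number nor the upper bound $1/(1-r)^2$ by a smaller number so that the inequality remains valid for all $f\in\mathcal{F}_0$ and all $|z|=r$.
   Context: $\mathbb{D}=\{z\in\mathbb{C}:|z|<1\}$. $\mathcal{H}$ is the class of all complex-valued harmonic mappings $f=h+\overline{g}$ in $\mathbb{D}$ with $h,g$ analytic in $\mathbb{D}$ and $h(0)=h'(0)-1=g(0)=0$, so that $h(z)=z+\sum_{n=2}^\infty a_nz^n$ and $g(z)=\sum_{n=1}^\infty b_nz^n$. $Aut(\mathbb{D})=\{e^{i\theta}\frac{z-a}{1-\overline{a}z}: a\in\mathbb{D},\ \theta\in\mathbb{R}\}$. $\mathcal{F}_0$ is the class of all $f=h+\overline{g}\in\mathcal{H}$ such that $h'\ne 0$ in $\mathbb{D}$, $$\mathrm{Re}\left(1+\frac{zh''(z)}{h'(z)}\right)>0\quad\text{for all } z\in\mathbb{D},$$ and the dilatation $\omega_f=g'/h'$ belongs to $Aut(\mathbb{D})$. *)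

theory Defs
  imports "HOL-Complex_Analysis.Complex_Analysis"
begin

abbreviation unit_disc :: "complex set" where
  "unit_disc \<equiv> ball 0 1"

(* A mapping of the disc is represented by a total function whose values
   outside the disc are unconstrained; all conditions are imposed on the disc. *)

definition harmonic_decomp ::
  "(complex \<Rightarrow> complex) \<Rightarrow> (complex \<Rightarrow> complex) \<Rightarrow> (complex \<Rightarrow> complex) \<Rightarrow> bool" where
  "harmonic_decomp f h g \<longleftrightarrow>
     h holomorphic_on unit_disc \<and> g holomorphic_on unit_disc \<and>
     h 0 = 0 \<and> deriv h 0 = 1 \<and> g 0 = 0 \<and>
     (\<forall>z\<in>unit_disc. f z = h z + cnj (g z))"

definition class_H :: "(complex \<Rightarrow> complex) set" where
  "class_H = {f. \<exists>h g. harmonic_decomp f h g}"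

definition Aut_disc :: "(complex \<Rightarrow> complex) set" where
  "Aut_disc = {\<phi>. \<exists>a\<in>unit_disc. \<exists>\<theta>::real. \<forall>z\<in>unit_disc.
     \<phi> z = exp (\<i> * of_real \<theta>) * ((z - a) / (1 - cnj a * z))}"

definition dilatation :: "(complex \<Rightarrow> complex) \<Rightarrow> (complex \<Rightarrow> complex) \<Rightarrow> complex \<Rightarrow> complex" where
  "dilatation h g z = deriv g z / deriv h z"

(* On the disc, h and g are determined by f: the normalisation g 0 = 0 fixes the
   additive constant. So the existential quantifier below ranges over the
   decomposition of f. *)
definition class_F0 :: "(complex \<Rightarrow> complex) set" where
  "class_F0 = {f \<in> class_H. \<exists>h g. harmonic_decomp f h g \<and>
     (\<forall>z\<in>unit_disc. deriv h z \<noteq> 0) \<and>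
     (\<forall>z\<in>unit_disc. Re (1 + z * deriv (deriv h) z / deriv h z) > 0) \<and>
     dilatation h g \<in> Aut_disc}"

end

theory Submission
  imports Defs
begin

text \<open>
  On the disc \<open>g' = \<omega> h'\<close>, and a disc automorphism satisfies \<open>\<bar>\<omega>\<bar> < 1\<close>. The upper bound is
  therefore the classical distortion theorem for convex univalent functions,
  \<open>\<bar>h'(z)\<bar> \<le> 1 / (1 - r)\<^sup>2\<close>. It follows from the analytic convexity condition: the
  function \<open>1 + z h''/h'\<close> has positive real part and takes the value \<open>1\<close> at the origin, so
  its Cayley transform satisfies the Schwarz lemma, which yields
  \<open>\<bar>h''/h'\<bar> \<le> 2 / (1 - r)\<close> (\<open>positive_real_part_bound\<close>); integrating the real part of
  \<open>h''/h' = (log h')'\<close> along a radius gives the bound (\<open>convex_derivative_growth\<close>).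

  Membership in the class only asserts that \<^emph>\<open>some\<close> decomposition of \<open>f\<close> is well behaved;
  \<open>harmonic_decomp_deriv_unique\<close> transfers the estimate to any other one.

  For sharpness one analytic part suffices, the half-plane map \<open>h(z) = z / (1 - z)\<close>, whose
  derivative attains the distortion bound at \<open>z = r\<close>. The dilatation can be prescribed freely:
  choosing its zero at \<open>r\<close> makes \<open>g'\<close> vanish there, while letting its zero \<open>-s\<close> tend to \<open>-1\<close>
  makes \<open>\<omega>(r) = (r + s) / (1 + s r)\<close> tend to \<open>1\<close>. The upper bound is thus a supremum that is
  approached but never attained.
\<close>

section \<open>Uniqueness of the harmonic decomposition\<close>

text \<open>Two decompositions of the same mapping differ by a function that is both holomorphic and
  antiholomorphic, hence has derivative zero.\<close>
lemma harmonic_decomp_deriv_unique: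
  assumes "harmonic_decomp f h g" and "harmonic_decomp f h' g'" and z: "z \<in> unit_disc"
  shows "deriv h z = deriv h' z" and "deriv g z = deriv g' z"
proof -
  define H where "H w = h w - h' w" for w
  define K where "K w = g' w - g w" for w
  have hol: "h holomorphic_on unit_disc" "h' holomorphic_on unit_disc"
            "g holomorphic_on unit_disc" "g' holomorphic_on unit_disc"
    and eq: "\<And>w. w \<in> unit_disc \<Longrightarrow> h w + cnj (g w) = h' w + cnj (g' w)"
    using assms(1,2) by (auto simp: harmonic_decomp_def)
  define A where "A = deriv h z - deriv h' z"
  define B where "B = deriv g' z - deriv g z"
  have dH: "(H has_field_derivative A) (at z)" and dK: "(K has_field_derivative B) (at z)"
    unfolding H_def K_def A_def B_def using hol z
    by (auto intro!: derivative_eq_intros holomorphic_derivI[OF _ open_ball])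
  have "(H has_derivative (\<lambda>v. A * v)) (at z)"
    using dH by (simp add: has_field_derivative_def)
  moreover have "(H has_derivative (\<lambda>v. cnj (B * v))) (at z)"
  proof (rule has_derivative_transform_within_open)
    show "((\<lambda>w. cnj (K w)) has_derivative (\<lambda>v. cnj (B * v))) (at z)"
      using dK unfolding has_field_derivative_def
      by (rule bounded_linear.has_derivative[OF bounded_linear_cnj])
    show "cnj (K w) = H w" if "w \<in> unit_disc" for w
      using eq[OF that] by (simp add: H_def K_def algebra_simps)
  qed (use z in auto)
  ultimately have "(\<lambda>v. A * v) = (\<lambda>v. cnj (B * v))"
    by (rule has_derivative_unique)
  \<comment> \<open>The derivative of \<open>H\<close> is both complex linear and conjugate linear; the
    directions \<open>1\<close> and \<open>\<i>\<close> show that such a map is zero.\<close>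
  from fun_cong[OF this, of 1] fun_cong[OF this, of \<i>]
  have "A = cnj B" and "A * \<i> = - (\<i> * cnj B)" by auto
  then have "A = 0" and "B = 0" by auto
  then show "deriv h z = deriv h' z" and "deriv g z = deriv g' z"
    by (auto simp: A_def B_def)
qed

section \<open>Distortion of convex functions\<close>

text \<open>The point \<open>1 + z q(z)\<close> lies in the right half-plane, which \<open>p \<mapsto> (p - 1) / (p + 1)\<close> maps
  onto the disc with \<open>1\<close> going to \<open>0\<close>. So \<open>w = z q / (2 + z q)\<close> is a Schwarz function, and
  \<open>z q = 2 w / (1 - w)\<close> with \<open>\<bar>w\<bar> \<le> \<bar>z\<bar>\<close>.\<close>
lemma positive_real_part_bound:
  fixes q :: "complex \<Rightarrow> complex"
  assumes holq: "q holomorphic_on unit_disc"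
    and pos: "\<And>z. z \<in> unit_disc \<Longrightarrow> Re (1 + z * q z) > 0"
    and z: "z \<in> unit_disc"
  shows "norm (q z) \<le> 2 / (1 - norm z)"
proof -
  define w where "w \<zeta> = \<zeta> * q \<zeta> / (2 + \<zeta> * q \<zeta>)" for \<zeta>
  have den: "2 + \<zeta> * q \<zeta> \<noteq> 0" if "\<zeta> \<in> unit_disc" for \<zeta>
  proof
    assume "2 + \<zeta> * q \<zeta> = 0"
    then have "Re (1 + (1 + \<zeta> * q \<zeta>)) = 0" by (simp add: add.assoc[symmetric])
    then show False using pos[OF that] by simp
  qed
  have holw: "w holomorphic_on ball 0 1"
    unfolding w_def using den by (intro holomorphic_intros holq) auto
  have w0: "w 0 = 0" by (simp add: w_def)
  have w_less: "norm (w \<zeta>) < 1" if "norm \<zeta> < 1" for \<zeta>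
  proof -
    define x where "x = \<zeta> * q \<zeta>"
    have "Re (1 + x) > 0" and "2 + x \<noteq> 0"
      using pos[of \<zeta>] den[of \<zeta>] that by (auto simp: x_def)
    then have "(norm x)\<^sup>2 < (norm (2 + x))\<^sup>2"
      unfolding cmod_power2 by (simp add: power2_eq_square algebra_simps)
    then have "norm x < norm (2 + x)"
      by (rule power2_less_imp_less) simp
    then show ?thesis
      using \<open>2 + x \<noteq> 0\<close> by (simp add: w_def x_def[symmetric] norm_divide)
  qed
  show ?thesis
  proof (cases "z = 0")
    \<comment> \<open>Dividing by \<open>z\<close> is impossible here; the derivative part of the Schwarz lemma
      applies instead, because \<open>w'(0) = q(0) / 2\<close>.\<close>
    case True
    have "(\<lambda>\<zeta>. q \<zeta> / (2 + \<zeta> * q \<zeta>)) holomorphic_on unit_disc"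
      using den by (intro holomorphic_intros holq) auto
    then obtain D where "((\<lambda>\<zeta>. q \<zeta> / (2 + \<zeta> * q \<zeta>)) has_field_derivative D) (at 0)"
      by (meson centre_in_ball holomorphic_on_open open_ball zero_less_one)
    from DERIV_mult[OF DERIV_ident this] have "(w has_field_derivative q 0 / 2) (at 0)"
      by (simp add: w_def[abs_def])
    then have "norm (q 0 / 2) \<le> 1"
      using Schwarz_Lemma(2)[OF holw w0 w_less, of 0] by (simp add: DERIV_imp_deriv)
    then show ?thesis using True by (simp add: norm_divide)
  next
    case nz: False
    have "norm (w z) \<le> norm z"
      using Schwarz_Lemma(1)[OF holw w0 w_less, of z] z by simp
    have "z * q z * (1 - w z) = 2 * w z"
      using den[OF z] by (simp add: w_def field_simps)
    then have eq: "norm z * norm (q z) * norm (1 - w z) = 2 * norm (w z)"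
      by (metis norm_mult norm_numeral)
    have "1 - norm z \<le> norm (1 - w z)"
      using \<open>norm (w z) \<le> norm z\<close> norm_triangle_ineq2[of 1 "w z"] by simp
    then have "norm z * norm (q z) * (1 - norm z) \<le> norm z * norm (q z) * norm (1 - w z)"
      by (intro mult_left_mono) auto
    also have "\<dots> \<le> 2 * norm z" using eq \<open>norm (w z) \<le> norm z\<close> by simp
    finally have "norm z * (norm (q z) * (1 - norm z)) \<le> norm z * 2" by (simp add: mult_ac)
    then have "norm (q z) * (1 - norm z) \<le> 2"
      by (rule mult_left_le_imp_le) (use nz in simp)
    then show ?thesis using z by (simp add: field_simps)
  qed
qed

text \<open>Applied to \<open>p = h'\<close> with \<open>h\<close> convex. Since \<open>(log p)' = p'/p\<close> has modulus at most
  \<open>2 / (1 - t)\<close> on the circle of radius \<open>t\<close>, the function \<open>log \<bar>p\<bar>\<close> grows along a radius no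
  faster than \<open>- 2 log (1 - t)\<close>.\<close>
lemma convex_derivative_growth:
  fixes p :: "complex \<Rightarrow> complex"
  assumes holp: "p holomorphic_on unit_disc" and p0: "p 0 = 1"
    and nz: "\<And>z. z \<in> unit_disc \<Longrightarrow> p z \<noteq> 0"
    and pos: "\<And>z. z \<in> unit_disc \<Longrightarrow> Re (1 + z * deriv p z / p z) > 0"
    and z: "z \<in> unit_disc"
  shows "norm (p z) \<le> 1 / (1 - norm z)\<^sup>2"
proof (cases "z = 0")
  case True
  then show ?thesis by (simp add: p0)
next
  case False
  define q where "q \<zeta> = deriv p \<zeta> / p \<zeta>" for \<zeta>
  have holq: "q holomorphic_on unit_disc"
    unfolding q_def using holp nz by (intro holomorphic_intros) auto
  have bound: "norm (q \<zeta>) \<le> 2 / (1 - norm \<zeta>)" if "\<zeta> \<in> unit_disc" for \<zeta>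
    by (rule positive_real_part_bound[OF holq _ that]) (use pos in \<open>simp add: q_def\<close>)
  obtain L where holL: "L holomorphic_on unit_disc"
    and expL: "\<And>\<zeta>. \<zeta> \<in> unit_disc \<Longrightarrow> p \<zeta> = exp (L \<zeta>)"
    using contractible_imp_holomorphic_log[OF holp _ nz]
    by (metis convex_ball convex_imp_contractible)
  have dL: "(L has_field_derivative q \<zeta>) (at \<zeta>)" if "\<zeta> \<in> unit_disc" for \<zeta>
  proof -
    have L: "(L has_field_derivative deriv L \<zeta>) (at \<zeta>)"
      by (rule holomorphic_derivI[OF holL open_ball that])
    have "((\<lambda>x. exp (L x)) has_field_derivative exp (L \<zeta>) * deriv L \<zeta>) (at \<zeta>)"
      by (auto intro!: derivative_eq_intros L)
    then have "(p has_field_derivative p \<zeta> * deriv L \<zeta>) (at \<zeta>)"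
      using expL that by (auto intro: has_field_derivative_transform_within_open[OF _ open_ball that])
    then have "deriv L \<zeta> = q \<zeta>"
      using nz[OF that] by (simp add: DERIV_imp_deriv q_def)
    then show ?thesis using L by simp
  qed
  define r where "r = norm z"
  define u where "u = z / of_real r"
  have r: "0 < r" "r < 1" and u: "norm u = 1" and zu: "z = of_real r * u"
    using False z by (auto simp: r_def u_def norm_divide)
  define \<phi> where "\<phi> t = Re (L (of_real t * u)) + 2 * ln (1 - t)" for t
  have inball: "of_real t * u \<in> unit_disc" if "0 \<le> t" "t \<le> r" for t
    using that r u by (simp add: norm_mult)
  have d\<phi>: "(\<phi> has_field_derivative Re (u * q (of_real t * u)) - 2 / (1 - t)) (at t)"
    if "0 \<le> t" "t \<le> r" for t
  proof -
    have "((\<lambda>t. of_real t * u) has_vector_derivative u) (at t)"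
      by (auto intro!: derivative_eq_intros)
    from field_vector_diff_chain_at[OF this dL[OF inball[OF that]]]
    have "((\<lambda>t. L (of_real t * u)) has_vector_derivative u * q (of_real t * u)) (at t)"
      by (simp add: o_def)
    then have "((\<lambda>t. Re (L (of_real t * u))) has_field_derivative Re (u * q (of_real t * u))) (at t)"
      by (rule has_field_derivative_Re)
    moreover have "((\<lambda>t. 2 * ln (1 + - t)) has_field_derivative - (2 / (1 + - t))) (at t)"
      using that r by (auto intro!: derivative_eq_intros)
    ultimately show ?thesis
      unfolding \<phi>_def diff_conv_add_uminus by (rule DERIV_add)
  qed
  have "\<phi> r \<le> \<phi> 0"
  proof (rule DERIV_nonpos_imp_decreasing_open[where f = \<phi>])
    show "continuous_on {0..r} \<phi>"
      by (intro continuous_at_imp_continuous_on ballI DERIV_isCont[OF d\<phi>]) auto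
    fix t assume t: "0 < t" "t < r"
    have "Re (u * q (of_real t * u)) \<le> norm (u * q (of_real t * u))" by (rule complex_Re_le_cmod)
    also have "\<dots> = norm (q (of_real t * u))" using u by (simp add: norm_mult)
    also have "\<dots> \<le> 2 / (1 - t)"
      using bound[OF inball, of t] t u by (simp add: norm_mult)
    finally show "\<exists>y. (\<phi> has_real_derivative y) (at t) \<and> y \<le> 0"
      using d\<phi>[of t] t by (intro exI conjI) auto
  qed (use r in auto)
  moreover have "Re (L 0) = 0"
    using expL[of 0] p0 by (metis centre_in_ball exp_eq_one_iff norm_exp_eq_Re norm_one zero_less_one)
  ultimately have "Re (L z) \<le> - (2 * ln (1 - r))" by (simp add: \<phi>_def zu)
  then have "exp (Re (L z)) \<le> exp (- (2 * ln (1 - r)))" by simp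
  also have "\<dots> = 1 / (1 - r)\<^sup>2"
    using r by (simp add: exp_minus exp_double inverse_eq_divide)
  finally show ?thesis using expL[OF z] by (simp add: r_def norm_exp_eq_Re)
qed

section \<open>Mappings over the half-plane map\<close>

lemma deriv_half_plane_map:
  fixes z :: complex
  assumes "z \<noteq> 1"
  shows "deriv (\<lambda>z. z / (1 - z)) z = 1 / (1 - z)\<^sup>2"
    and "deriv (deriv (\<lambda>z. z / (1 - z))) z = 2 / (1 - z) ^ 3"
proof -
  have d: "deriv (\<lambda>z. z / (1 - z)) w = 1 / (1 - w)\<^sup>2" if "w \<noteq> 1" for w :: complex
    using that by (intro DERIV_imp_deriv)
      (auto intro!: derivative_eq_intros simp: field_simps power2_eq_square)
  show "deriv (\<lambda>z. z / (1 - z)) z = 1 / (1 - z)\<^sup>2" by (rule d[OF assms])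
  have "((\<lambda>x. 1 / x\<^sup>2) has_field_derivative - 2 / w ^ 3) (at w)" if "w \<noteq> 0" for w :: complex
    using that by (auto intro!: derivative_eq_intros simp: eval_nat_numeral)
  moreover have "((\<lambda>w. 1 - w) has_field_derivative - 1) (at z)"
    by (auto intro!: derivative_eq_intros)
  ultimately have "((\<lambda>w. 1 / (1 - w)\<^sup>2) has_field_derivative - 2 / (1 - z) ^ 3 * - 1) (at z)"
    using assms by (intro DERIV_chain2) auto
  then have "((\<lambda>w. 1 / (1 - w)\<^sup>2) has_field_derivative 2 / (1 - z) ^ 3) (at z)"
    by simp
  then have "(deriv (\<lambda>z. z / (1 - z)) has_field_derivative 2 / (1 - z) ^ 3) (at z)"
    by (rule has_field_derivative_transform_within_open[of _ _ _ "- {1}"])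
       (use assms d in auto)
  then show "deriv (deriv (\<lambda>z. z / (1 - z))) z = 2 / (1 - z) ^ 3"
    by (rule DERIV_imp_deriv)
qed

text \<open>The half-plane map \<open>h(z) = z / (1 - z)\<close> is convex, because
  \<open>1 + z h''/h' = (1 + z) / (1 - z)\<close>. Given the zero \<open>a\<close> of the dilatation, \<open>g\<close> is the primitive
  of \<open>\<omega> h'\<close> that vanishes at the origin.\<close>
lemma half_plane_member_with_dilatation:
  assumes a: "a \<in> unit_disc"
  obtains f h g where "f \<in> class_F0" and "harmonic_decomp f h g"
    and "\<And>z. z \<in> unit_disc \<Longrightarrow> deriv g z = (z - a) / (1 - cnj a * z) / (1 - z)\<^sup>2"
proof -
  define h :: "complex \<Rightarrow> complex" where "h = (\<lambda>z. z / (1 - z))"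
  define G where "G z = (z - a) / (1 - cnj a * z) / (1 - z)\<^sup>2" for z
  have ne1: "z \<noteq> 1" if "z \<in> unit_disc" for z :: complex using that by auto
  have nea: "1 - cnj a * z \<noteq> 0" if "z \<in> unit_disc" for z
  proof -
    have "norm (cnj a * z) < 1 * 1"
      unfolding norm_mult using a that by (intro mult_strict_mono') auto
    then show ?thesis by auto
  qed
  have "G holomorphic_on unit_disc"
    unfolding G_def using nea ne1 by (intro holomorphic_intros) auto
  then obtain g0 where g0: "\<And>z. z \<in> unit_disc \<Longrightarrow> (g0 has_field_derivative G z) (at z)"
    using holomorphic_convex_primitive'[of unit_disc G]
    by (metis at_within_open convex_ball open_ball)
  define g where "g z = g0 z - g0 0" for z
  have dg: "(g has_field_derivative G z) (at z)" if "z \<in> unit_disc" for z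
    unfolding g_def using g0[OF that] by (auto intro!: derivative_eq_intros)
  then have dG: "deriv g z = G z" if "z \<in> unit_disc" for z
    using that by (auto intro: DERIV_imp_deriv)
  have holg: "g holomorphic_on unit_disc"
    using dg by (meson holomorphic_on_open open_ball)
  have holh: "h holomorphic_on unit_disc"
    unfolding h_def using ne1 by (intro holomorphic_intros) auto
  define f where "f z = h z + cnj (g z)" for z
  have dh: "deriv h z = 1 / (1 - z)\<^sup>2" "deriv (deriv h) z = 2 / (1 - z) ^ 3"
    if "z \<in> unit_disc" for z
    unfolding h_def by (rule deriv_half_plane_map[OF ne1[OF that]])+
  have decomp: "harmonic_decomp f h g"
    using holg holh dh(1)[of 0] by (auto simp: harmonic_decomp_def f_def h_def g_def)
  have "Re (1 + z * deriv (deriv h) z / deriv h z) > 0" if "z \<in> unit_disc" for z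
  proof -
    have "1 + z * deriv (deriv h) z / deriv h z = 1 + 2 * z / (1 - z)"
      unfolding dh[OF that] using ne1[OF that] by (simp add: power2_eq_square power3_eq_cube)
    also have "\<dots> = (1 + z) / (1 - z)"
      using ne1[OF that] by (simp add: field_simps)
    also have "\<dots> = (1 + z) * cnj (1 - z) / of_real ((norm (1 - z))\<^sup>2)"
      by (subst complex_div_cnj) simp
    also have "Re \<dots> = Re ((1 + z) * cnj (1 - z)) / (norm (1 - z))\<^sup>2"
      by (rule Re_divide_of_real)
    also have "Re ((1 + z) * cnj (1 - z)) = 1 - (norm z)\<^sup>2"
      unfolding cmod_power2 by (simp add: power2_eq_square algebra_simps)
    also have "(1 - (norm z)\<^sup>2) / (norm (1 - z))\<^sup>2 > 0"
      using that ne1[OF that] by (simp add: abs_square_less_1)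
    finally show ?thesis .
  qed
  moreover have "deriv h z \<noteq> 0" if "z \<in> unit_disc" for z
    using dh[OF that] ne1[OF that] by simp
  moreover have "dilatation h g \<in> Aut_disc"
    unfolding Aut_disc_def
  proof (intro CollectI bexI[OF _ a] exI[of _ 0] ballI)
    fix z assume "z \<in> unit_disc"
    then show "dilatation h g z = exp (\<i> * of_real 0) * ((z - a) / (1 - cnj a * z))"
      using ne1[of z] by (simp add: dilatation_def dh dG G_def)
  qed
  ultimately have "f \<in> class_F0"
    using decomp unfolding class_F0_def class_H_def by blast
  then show thesis
    using decomp dG by (intro that) (auto simp: G_def)
qed

section \<open>The sharp estimate\<close>

theorem theorem4p4:
  shows "(\<forall>f h g z. f \<in> class_F0 \<and> harmonic_decomp f h g \<and> norm z < 1 \<longrightarrow>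
            0 \<le> norm (deriv g z) \<and> norm (deriv g z) \<le> 1 / (1 - norm z)\<^sup>2) \<and>
         (\<forall>r::real. 0 \<le> r \<and> r < 1 \<longrightarrow>
            \<not> (\<exists>m::real. m > 0 \<and>
                (\<forall>f h g z. f \<in> class_F0 \<and> harmonic_decomp f h g \<and> norm z = r \<longrightarrow>
                   m \<le> norm (deriv g z))) \<and>
            \<not> (\<exists>M::real. M < 1 / (1 - r)\<^sup>2 \<and>
                (\<forall>f h g z. f \<in> class_F0 \<and> harmonic_decomp f h g \<and> norm z = r \<longrightarrow>
                   norm (deriv g z) \<le> M)))"
proof (intro conjI allI impI)
  fix f h g :: "complex \<Rightarrow> complex" and z :: complex
  assume asm: "f \<in> class_F0 \<and> harmonic_decomp f h g \<and> norm z < 1"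
  then have z: "z \<in> unit_disc" by simp
  from asm obtain k l where kl: "harmonic_decomp f k l"
    and nz: "\<And>z. z \<in> unit_disc \<Longrightarrow> deriv k z \<noteq> 0"
    and pos: "\<And>z. z \<in> unit_disc \<Longrightarrow> Re (1 + z * deriv (deriv k) z / deriv k z) > 0"
    and aut: "dilatation k l \<in> Aut_disc"
    by (auto simp: class_F0_def)
  have kd: "deriv k holomorphic_on unit_disc" "deriv k 0 = 1"
    using kl by (auto simp: harmonic_decomp_def intro!: holomorphic_deriv)
  obtain a \<theta> where "a \<in> unit_disc"
    and "\<forall>z\<in>unit_disc. dilatation k l z = exp (\<i> * of_real \<theta>) * ((z - a) / (1 - cnj a * z))"
    using aut unfolding Aut_disc_def mem_Collect_eq by (elim bexE exE) (rule that)
  then have a: "norm a < 1" and dil: "deriv l z / deriv k z = Moebius_function \<theta> a z"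
    using z by (simp_all add: dilatation_def Moebius_function_def)
  have "norm (deriv g z) = norm (deriv l z)"
    using harmonic_decomp_deriv_unique(2)[of f h g k l z] kl z asm by simp
  also have "\<dots> = norm (Moebius_function \<theta> a z) * norm (deriv k z)"
    using nz[OF z] by (simp add: dil[symmetric] norm_divide)
  also have "\<dots> \<le> 1 * (1 / (1 - norm z)\<^sup>2)"
    using Moebius_function_norm_lt_1[OF a, of z \<theta>] asm
      convex_derivative_growth[OF kd nz pos z]
    by (intro mult_mono) auto
  finally show "norm (deriv g z) \<le> 1 / (1 - norm z)\<^sup>2" by simp
next
  fix r :: real assume r: "0 \<le> r \<and> r < 1"
  have rin: "complex_of_real r \<in> unit_disc" and rnorm: "norm (complex_of_real r) = r"
    using r by auto
  show "\<not> (\<exists>m::real. m > 0 \<and>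
           (\<forall>f h g z. f \<in> class_F0 \<and> harmonic_decomp f h g \<and> norm z = r \<longrightarrow>
              m \<le> norm (deriv g z)))"
  proof safe
    fix m :: real
    assume m: "m > 0" and le: "\<forall>f h g z. f \<in> class_F0 \<and> harmonic_decomp f h g \<and> norm z = r
      \<longrightarrow> m \<le> norm (deriv g z)"
    obtain f h g where fhg: "f \<in> class_F0" "harmonic_decomp f h g"
      and dg: "\<And>z. z \<in> unit_disc \<Longrightarrow>
        deriv g z = (z - of_real r) / (1 - cnj (of_real r) * z) / (1 - z)\<^sup>2"
      by (rule half_plane_member_with_dilatation[OF rin]) (rule that; blast)
    have "deriv g r = 0" by (simp add: dg[OF rin])
    with le[rule_format, of f h g "of_real r"] fhg rnorm m show False by simp
  qed
  show "\<not> (\<exists>M::real. M < 1 / (1 - r)\<^sup>2 \<and>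
           (\<forall>f h g z. f \<in> class_F0 \<and> harmonic_decomp f h g \<and> norm z = r \<longrightarrow>
              norm (deriv g z) \<le> M))"
  proof safe
    fix M :: real
    assume M: "M < 1 / (1 - r)\<^sup>2" and le: "\<forall>f h g z. f \<in> class_F0 \<and> harmonic_decomp f h g \<and> norm z = r
      \<longrightarrow> norm (deriv g z) \<le> M"
    \<comment> \<open>The mapping whose dilatation vanishes at \<open>-s\<close>, evaluated at the point \<open>r\<close>.\<close>
    have le': "(r + s) / (1 + s * r) / (1 - r)\<^sup>2 \<le> M" if s: "0 < s" "s < 1" for s :: real
    proof -
      have sin: "- complex_of_real s \<in> unit_disc" using s by simp
      obtain f h g where fhg: "f \<in> class_F0" "harmonic_decomp f h g"
        and dg: "\<And>z. z \<in> unit_disc \<Longrightarrow>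
          deriv g z = (z - - of_real s) / (1 - cnj (- of_real s) * z) / (1 - z)\<^sup>2"
        by (rule half_plane_member_with_dilatation[OF sin]) (rule that; blast)
      have "deriv g r = complex_of_real ((r + s) / (1 + s * r) / (1 - r)\<^sup>2)"
        by (simp add: dg[OF rin])
      moreover have "(r + s) / (1 + s * r) / (1 - r)\<^sup>2 \<ge> 0" using r s by simp
      ultimately have "norm (deriv g r) = (r + s) / (1 + s * r) / (1 - r)\<^sup>2"
        by (metis norm_of_real abs_of_nonneg)
      with le[rule_format, of f h g "of_real r"] fhg rnorm show ?thesis by simp
    qed
    have "((\<lambda>s. (r + s) / (1 + s * r) / (1 - r)\<^sup>2) \<longlongrightarrow> (r + 1) / (1 + 1 * r) / (1 - r)\<^sup>2) (at_left 1)"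
      using r by (intro tendsto_intros) auto
    moreover have "eventually (\<lambda>s. (r + s) / (1 + s * r) / (1 - r)\<^sup>2 \<le> M) (at_left 1)"
      using eventually_at_left_real[of 0 "1::real"] le' by (auto elim!: eventually_mono)
    ultimately have "(r + 1) / (1 + 1 * r) / (1 - r)\<^sup>2 \<le> M"
      by (rule tendsto_upperbound) auto
    then show False using M r by (simp add: add.commute)
  qed
qed simp

end
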